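(* Let $\mathcal{G}=(V,(V_1,V_2,V_P),\delta)$ with reward function $r$ be a stochastic game with rewards that is stopping under fairness. Then for every vertex $v\in V$, $\sup_{\pi_1\in\Pi_1}\inf_{\pi_2\in\Pi_2^{F}}\mathbb{E}^{\pi_1,\pi_2}_{\mathcal{G},v}[\mathrm{rew}]=\sup_{\pi_1\in\Pi_1^{M}}\inf_{\pi_2\in\Pi_2^{MF}}\mathbb{E}^{\pi_1,\pi_2}_{\mathcal{G},v}[\mathrm{rew}]$, where $\Pi_1$ is the set of all Player 1 strategies, $\Pi_1^{M}$ the set of memoryless Player 1 strategies, $\Pi_2^{F}$ the set of fair Player 2 strategies, and $\Pi_2^{MF}$ the set of memoryless fair Player 2 strategies.
   Context: A stochastic game is a tuple $\mathcal{G}=(V,(V_1,V_2,V_P),\delta)$ where $V$ is a finite set of vertices, $V_1,V_2,V_P$ form a partition of $V$, and $\delta:V\times V\to[0,1]$ satisfies $\delta(v,v')\in\{0,1\}$ for $v\in V_1\cup V_2$, $v'\in V$, and $\delta(v,\cdot)$ is a probability distribution on $V$ for $v\in V_P$. Let $\mathrm{post}(v)=\{v'\mid \delta(v,v')>0\}$; it is assumed $\mathrm{post}(v)\neq\emptyset$ for all $v$. A vertex $v$ is terminal if $\delta(v,v)=1$ and $\delta(v,v')=0$ for $v'\neq v$; $T$ is the set of terminal vertices. A path is an infinite sequence $\omega=v_0v_1\dots$ with $\delta(v_k,v_{k+1})>0$ for all $k$; $\inf(\omega)$ is the set of vertices occurring infinitely often in $\omega$. A strategy for Player $i\in\{1,2\}$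 is a function $\pi_i:V^*V_i\to\mathcal{D}(V)$ with $\pi_i(\hat\omega u)(u')>0$ only if $u'\in\mathrm{post}(u)$; it is memoryless if $\pi_i(\hat\omega u)$ depends only on $u$. Given strategies $\pi_1,\pi_2$ and initial vertex $v$, $\Pr^{\pi_1,\pi_2}_{\mathcal{G},v}$ is the induced probability measure on paths starting at $v$. $\Diamond T$ is the set of paths visiting $T$. Fair plays: $FP^2=\{\omega\mid \forall v'\in V_2:\ v'\in\inf(\omega)\Rightarrow \mathrm{post}(v')\subseteq\inf(\omega)\}$; a Player 2 strategy $\pi_2$ is fair if $\Pr^{\pi_1,\pi_2}_{\mathcal{G},u}(FP^2)=1$ for every Player 1 strategy $\pi_1$ and every $u\in V$. $\mathcal{G}$ is stopping under fairness if $\Pr^{\pi_1,\pi_2}_{\mathcal{G},u}(\Diamond T)=1$ for all Player 1 strategies $\pi_1$, all fair Player 2 strategies $\pi_2$, and all $u\in V$. A stochastic game with rewards additionally has a reward function $r:V\to\mathbb{R}_{\ge0}$ with $r(u)=0$ for every terminal $u$; $\mathrm{rew}(\omega)=\sum_{i\ge0}r(\omega_i)$ and $\mathbb{E}^{\pi_1,\pi_2}_{\mathcal{G},v}[\mathrm{rew}]$ is the expectation of $\mathrm{rew}$ under $\Pr^{\pi_1,\pi_2}_{\mathcal{G},v}$. *)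

theory Defs
  imports "HOL-Probability.Probability"
begin

text \<open>The vertex set is the whole of a finite type \<open>'v\<close>.\<close>

record 'v stochastic_game =
  V1 :: "'v set"
  V2 :: "'v set"
  VP :: "'v set"
  delta :: "'v \<Rightarrow> 'v \<Rightarrow> real"

record 'v reward_game = "'v stochastic_game" +
  reward :: "'v \<Rightarrow> real"

definition post :: "('v, 'x) stochastic_game_scheme \<Rightarrow> 'v \<Rightarrow> 'v set" where
  "post G v = {v'. delta G v v' > 0}"

definition stochastic_game :: "('v::finite, 'x) stochastic_game_scheme \<Rightarrow> bool" where
  "stochastic_game G \<longleftrightarrow>
     V1 G \<union> V2 G \<union> VP G = UNIV \<and>
     V1 G \<inter> V2 G = {} \<and> V1 G \<inter> VP G = {} \<and> V2 G \<inter> VP G = {} \<and>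
     (\<forall>v v'. 0 \<le> delta G v v' \<and> delta G v v' \<le> 1) \<and>
     (\<forall>v \<in> V1 G \<union> V2 G. \<forall>v'. delta G v v' \<in> {0, 1}) \<and>
     (\<forall>v \<in> VP G. (\<Sum>v'\<in>UNIV. delta G v v') = 1) \<and>
     (\<forall>v. post G v \<noteq> {})"

definition terminal :: "('v, 'x) stochastic_game_scheme \<Rightarrow> 'v set" where
  "terminal G = {v. delta G v v = 1 \<and> (\<forall>v'. v' \<noteq> v \<longrightarrow> delta G v v' = 0)}"

definition reward_game :: "('v::finite, 'x) reward_game_scheme \<Rightarrow> bool" where
  "reward_game G \<longleftrightarrow>
     stochastic_game G \<and> (\<forall>v. 0 \<le> reward G v) \<and> (\<forall>v \<in> terminal G. reward G v = 0)"


definition paths :: "('v, 'x) stochastic_game_scheme \<Rightarrow> (nat \<Rightarrow> 'v) set" where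
  "paths G = {\<omega>. \<forall>k. delta G (\<omega> k) (\<omega> (Suc k)) > 0}"

definition inf_visited :: "(nat \<Rightarrow> 'v) \<Rightarrow> 'v set" where
  "inf_visited \<omega> = {v. \<exists>\<^sub>\<infinity>k. \<omega> k = v}"

definition visiting :: "('v, 'x) stochastic_game_scheme \<Rightarrow> 'v set \<Rightarrow> (nat \<Rightarrow> 'v) set" where
  "visiting G A = {\<omega> \<in> paths G. \<exists>k. \<omega> k \<in> A}"

definition fair_paths2 :: "('v, 'x) stochastic_game_scheme \<Rightarrow> (nat \<Rightarrow> 'v) set" where
  "fair_paths2 G =
     {\<omega> \<in> paths G. \<forall>v' \<in> V2 G. v' \<in> inf_visited \<omega> \<longrightarrow> post G v' \<subseteq> inf_visited \<omega>}"

text \<open>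
  A strategy of the player owning \<open>U\<close> maps histories \<open>h @ [u]\<close> with \<open>u \<in> U\<close> to distributions.
  It is represented by a total function; its values on other lists are arbitrary and never used.
\<close>

type_synonym 'v strategy = "'v list \<Rightarrow> 'v pmf"

definition strategies :: "('v, 'x) stochastic_game_scheme \<Rightarrow> 'v set \<Rightarrow> 'v strategy set" where
  "strategies G U = {\<pi>. \<forall>h. \<forall>u \<in> U. \<forall>u'. pmf (\<pi> (h @ [u])) u' > 0 \<longrightarrow> u' \<in> post G u}"

definition memoryless_on :: "'v set \<Rightarrow> 'v strategy \<Rightarrow> bool" where
  "memoryless_on U \<pi> \<longleftrightarrow> (\<forall>u \<in> U. \<forall>h h'. \<pi> (h @ [u]) = \<pi> (h' @ [u]))"

definition strategies1 :: "('v, 'x) stochastic_game_scheme \<Rightarrow> 'v strategy set" where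
  "strategies1 G = strategies G (V1 G)"

definition strategies2 :: "('v, 'x) stochastic_game_scheme \<Rightarrow> 'v strategy set" where
  "strategies2 G = strategies G (V2 G)"

definition memoryless_strategies1 :: "('v, 'x) stochastic_game_scheme \<Rightarrow> 'v strategy set" where
  "memoryless_strategies1 G = {\<pi> \<in> strategies1 G. memoryless_on (V1 G) \<pi>}"


definition next_vertex ::
    "('v::finite, 'x) stochastic_game_scheme \<Rightarrow> 'v strategy \<Rightarrow> 'v strategy \<Rightarrow> 'v list \<Rightarrow> 'v pmf" where
  "next_vertex G \<pi>1 \<pi>2 h =
     (if last h \<in> V1 G then \<pi>1 h
      else if last h \<in> V2 G then \<pi>2 h
      else embed_pmf (delta G (last h)))"

definition path_kernel ::
    "('v::finite, 'x) stochastic_game_scheme \<Rightarrow> 'v strategy \<Rightarrow> 'v strategy \<Rightarrow> 'v \<Rightarrow>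
     nat \<Rightarrow> (nat \<Rightarrow> 'v) \<Rightarrow> 'v measure" where
  "path_kernel G \<pi>1 \<pi>2 v n \<omega> =
     measure_pmf (if n = 0 then return_pmf v else next_vertex G \<pi>1 \<pi>2 (map \<omega> [0..<n]))"

text \<open>
  The projective limit that the Ionescu-Tulcea theorem associates with the kernels above; the
  lemmas below show that the locale assumptions hold and compute the cylinder probabilities.
\<close>

definition path_measure ::
    "('v::finite, 'x) stochastic_game_scheme \<Rightarrow> 'v strategy \<Rightarrow> 'v strategy \<Rightarrow> 'v \<Rightarrow>
     (nat \<Rightarrow> 'v) measure" where
  "path_measure G \<pi>1 \<pi>2 v =
     projective_family.lim UNIV
       (Ionescu_Tulcea.CI (path_kernel G \<pi>1 \<pi>2 v) (\<lambda>_. count_space UNIV))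
       (\<lambda>_. count_space UNIV)"

definition fair_strategies2 :: "('v::finite, 'x) stochastic_game_scheme \<Rightarrow> 'v strategy set" where
  "fair_strategies2 G =
     {\<pi>2 \<in> strategies2 G.
        \<forall>\<pi>1 \<in> strategies1 G. \<forall>u. measure (path_measure G \<pi>1 \<pi>2 u) (fair_paths2 G) = 1}"

definition memoryless_fair_strategies2 ::
    "('v::finite, 'x) stochastic_game_scheme \<Rightarrow> 'v strategy set" where
  "memoryless_fair_strategies2 G = {\<pi> \<in> fair_strategies2 G. memoryless_on (V2 G) \<pi>}"

definition stopping_under_fairness :: "('v::finite, 'x) stochastic_game_scheme \<Rightarrow> bool" where
  "stopping_under_fairness G \<longleftrightarrow>
     (\<forall>\<pi>1 \<in> strategies1 G. \<forall>\<pi>2 \<in> fair_strategies2 G. \<forall>u.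
        measure (path_measure G \<pi>1 \<pi>2 u) (visiting G (terminal G)) = 1)"

definition total_reward :: "('v, 'x) reward_game_scheme \<Rightarrow> (nat \<Rightarrow> 'v) \<Rightarrow> ennreal" where
  "total_reward G \<omega> = (\<Sum>i. ennreal (reward G (\<omega> i)))"

definition expected_reward ::
    "('v::finite, 'x) reward_game_scheme \<Rightarrow> 'v strategy \<Rightarrow> 'v strategy \<Rightarrow> 'v \<Rightarrow> ennreal" where
  "expected_reward G \<pi>1 \<pi>2 v = (\<integral>\<^sup>+ \<omega>. total_reward G \<omega> \<partial>path_measure G \<pi>1 \<pi>2 v)"


lemma pmf_next_vertex_probabilistic:
  assumes "stochastic_game G" "last h \<in> VP G"
  shows "pmf (next_vertex G \<pi>1 \<pi>2 h) v' = delta G (last h) v'"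
proof -
  have "last h \<notin> V1 G" "last h \<notin> V2 G" "(\<Sum>v'\<in>UNIV. delta G (last h) v') = 1"
    and nn: "\<And>v'. 0 \<le> delta G (last h) v'"
    using assms by (auto simp: stochastic_game_def)
  then show ?thesis
    unfolding next_vertex_def
    by (simp, intro pmf_embed_pmf) (auto simp: nn_integral_count_space_finite)
qed

lemma sets_PiM_count_space:
  assumes "finite J"
  shows "sets (PiM J (\<lambda>_. count_space (UNIV :: 'v::finite set))) = Pow (PiE J (\<lambda>_. UNIV))"
  using assms by (subst count_space_PiM_finite) auto

lemma Ionescu_Tulcea_path_kernel:
  "Ionescu_Tulcea (path_kernel G \<pi>1 \<pi>2 v) (\<lambda>_. count_space (UNIV :: 'v::finite set))"
proof
  fix i
  have "path_kernel G \<pi>1 \<pi>2 v i x \<in> space (subprob_algebra (count_space UNIV))" for x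
    unfolding path_kernel_def by (rule measure_pmf_in_subprob_algebra)
  then show "path_kernel G \<pi>1 \<pi>2 v i
      \<in> measurable (PiM {0..<i} (\<lambda>_. count_space UNIV)) (subprob_algebra (count_space UNIV))"
    by (auto simp: measurable_def sets_PiM_count_space space_PiM)
qed (auto simp: path_kernel_def measure_pmf.prob_space_axioms)

lemma sets_path_measure [measurable_cong]:
  "sets (path_measure G \<pi>1 \<pi>2 v) = sets (PiM UNIV (\<lambda>_. count_space UNIV))"
proof -
  interpret Ionescu_Tulcea "path_kernel G \<pi>1 \<pi>2 v" "\<lambda>_. count_space UNIV"
    by (rule Ionescu_Tulcea_path_kernel)
  show ?thesis unfolding path_measure_def by (rule PF.sets_lim)
qed

lemma emeasure_path_measure_cylinder:
  "emeasure (path_measure G \<pi>1 \<pi>2 v) {\<omega>. \<forall>i\<le>n. \<omega> i = w i} =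
     indicator {v} (w 0) *
     (\<Prod>i<n. ennreal (pmf (next_vertex G \<pi>1 \<pi>2 (map w [0..<Suc i])) (w (Suc i))))"
proof -
  let ?M = "\<lambda>_::nat. count_space (UNIV :: 'a set)"
  interpret Ionescu_Tulcea "path_kernel G \<pi>1 \<pi>2 v" ?M
    by (rule Ionescu_Tulcea_path_kernel)
  define c where "c m = restrict w {0..<m}" for m
  have c_space: "c m \<in> space (PiM {0..<m} ?M)" for m
    by (auto simp: c_def space_PiM)
  have sets_c: "{c m} \<in> sets (PiM {0..<m} ?M)" for m
    using c_space[of m] by (simp add: sets_PiM_count_space space_PiM)
  have kernel_c: "path_kernel G \<pi>1 \<pi>2 v m (c m) = path_kernel G \<pi>1 \<pi>2 v m w" for m
  proof -
    have "map (c m) [0..<m] = map w [0..<m]" by (simp add: c_def)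
    then show ?thesis by (simp only: path_kernel_def)
  qed
  have C_eq: "emeasure (C 0 m (\<lambda>_. undefined)) {c m} =
      (\<Prod>i<m. emeasure (path_kernel G \<pi>1 \<pi>2 v i w) {w i})" for m
  proof (induction m)
    case 0
    have "c 0 = (\<lambda>_. undefined)" by (simp add: c_def fun_eq_iff)
    then show ?case using sets_c[of 0] by simp
  next
    case (Suc m)
    let ?C = "C 0 m (\<lambda>_. undefined)"
    have sp: "space ?C = space (PiM {0..<m} ?M)"
      using space_C[of "\<lambda>_. undefined" 0 m] by simp
    have sets: "sets ?C = sets (PiM {0..<m} ?M)"
      using sets_C[of "\<lambda>_. undefined" 0 m] by simp
    have eP_c: "emeasure (eP m x) {c (Suc m)} =
        emeasure (path_kernel G \<pi>1 \<pi>2 v m w) {w m} * indicator {c m} x"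
      if x: "x \<in> space (PiM {0..<m} ?M)" for x
    proof -
      have *: "emeasure (eP m x) {c (Suc m)} =
          emeasure (path_kernel G \<pi>1 \<pi>2 v m x) ((\<lambda>y. x(m := y)) -` {c (Suc m)})"
        by (subst emeasure_eP[OF x sets_c]) simp
      have upd: "x(m := y) = c (Suc m) \<longleftrightarrow> x = c m \<and> y = w m" for y
      proof
        assume eq: "x(m := y) = c (Suc m)"
        have "x i = c m i" for i
        proof (cases "i < m")
          case True
          then show ?thesis using fun_cong[OF eq, of i] by (simp add: c_def)
        next
          case False
          then show ?thesis using x by (auto simp: c_def space_PiM PiE_iff extensional_def)
        qed
        then show "x = c m \<and> y = w m" using fun_cong[OF eq, of m] by (auto simp: c_def)
      qed (auto simp: c_def fun_eq_iff)
      show ?thesis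
      proof (cases "x = c m")
        case True
        then have "(\<lambda>y. x(m := y)) -` {c (Suc m)} = {w m}" using upd by auto
        then show ?thesis unfolding * using True by (simp add: kernel_c)
      next
        case False
        then have "(\<lambda>y. x(m := y)) -` {c (Suc m)} = {}" using upd by auto
        then show ?thesis unfolding * using False by simp
      qed
    qed
    have "emeasure (C 0 (Suc m) (\<lambda>_. undefined)) {c (Suc m)} =
        (\<integral>\<^sup>+x. emeasure (eP m x) {c (Suc m)} \<partial>?C)"
      unfolding C.simps add_0
    proof (rule emeasure_bind[OF _ _ sets_c])
      show "space ?C \<noteq> {}" unfolding sp using c_space[of m] by blast
      show "eP m \<in> measurable ?C (subprob_algebra (PiM {0..<Suc m} ?M))"
        unfolding measurable_cong_sets[OF sets refl] by (rule measurable_eP)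
    qed
    also have "\<dots> = (\<integral>\<^sup>+x. emeasure (path_kernel G \<pi>1 \<pi>2 v m w) {w m} * indicator {c m} x \<partial>?C)"
      by (intro nn_integral_cong eP_c) (simp add: sp)
    also have "\<dots> = emeasure (path_kernel G \<pi>1 \<pi>2 v m w) {w m} * emeasure ?C {c m}"
      using sets_c[of m] by (intro nn_integral_cmult_indicator) (simp add: sets)
    finally show ?case by (simp add: Suc.IH mult.commute)
  qed
  have "{\<omega>. \<forall>i\<le>n. \<omega> i = w i} = prod_emb UNIV ?M {0..<Suc n} {c (Suc n)}"
  proof -
    have "restrict \<omega> {0..<Suc n} = c (Suc n) \<longleftrightarrow> (\<forall>i\<le>n. \<omega> i = w i)" for \<omega>
      unfolding c_def restrict_def fun_eq_iff by (metis atLeastLessThan_iff le0 less_Suc_eq_le)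
    then show ?thesis by (simp add: prod_emb_def vimage_def)
  qed
  then have "emeasure (path_measure G \<pi>1 \<pi>2 v) {\<omega>. \<forall>i\<le>n. \<omega> i = w i} =
      emeasure (CI {0..<Suc n}) {c (Suc n)}"
    unfolding path_measure_def using lim[OF _ sets_c] by simp
  also have "\<dots> = emeasure (C 0 (Suc n) (\<lambda>_. undefined)) {c (Suc n)}"
  proof -
    have "prod_emb {0..<Suc n} ?M {0..<Suc n} {c (Suc n)} = {c (Suc n)}"
      using c_space[of "Suc n"] by (intro prod_emb_id) (simp add: space_PiM)
    then show ?thesis using emeasure_CI[OF subset_refl sets_c, of "Suc n"] by simp
  qed
  also have "\<dots> = (\<Prod>i<Suc n. emeasure (path_kernel G \<pi>1 \<pi>2 v i w) {w i})"
    by (rule C_eq)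
  also have "\<dots> = indicator {v} (w 0) *
      (\<Prod>i<n. ennreal (pmf (next_vertex G \<pi>1 \<pi>2 (map w [0..<Suc i])) (w (Suc i))))"
    unfolding prod.lessThan_Suc_shift
    by (simp add: path_kernel_def emeasure_pmf_single indicator_def del: upt_Suc)
  finally show ?thesis .
qed

end

theory Submission
  imports Defs
begin

text \<open>
  Both sides equal one vector \<open>h\<close>. If there is no fair strategy both are infinite, so fix a fair one.
  By the stopping hypothesis Player 1 cannot trap the play outside \<open>T\<close> against it, which yields a
  positional Player 2 strategy \<open>d\<close> with a finite Lyapunov function bounding the expected time to
  reach \<open>T\<close> against every Player 1 strategy. Call such \<open>d\<close> proper. Proper strategies are fair, because
  a play that reaches \<open>T\<close> stays in one terminal vertex. Among the finitely many proper \<open>d\<close> pick one whose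
  best-response value \<open>h\<close> has minimal sum. A profitable one-vertex deviation of Player 2 would again be
  proper, so \<open>h\<close> satisfies the full minimax Bellman equation. Then \<open>h\<close> is a supermartingale bound for \<open>d\<close>
  against all Player 1 strategies, and a submartingale bound for the positional Player 1 strategy
  attaining the maxima against all fair Player 2 strategies, where \<open>h\<close> vanishes in the limit since \<open>T\<close>
  is reached almost surely.
\<close>

section \<open>The path measure: total mass, measurability and one-step expectations\<close>

text \<open>A projective limit has the same mass as each of its finite marginals, and the marginal
  on the empty index set suffices.\<close>

lemma prob_space_path_measure: "prob_space (path_measure G \<pi>1 \<pi>2 v)"
proof -
  interpret Ionescu_Tulcea "path_kernel G \<pi>1 \<pi>2 v" "\<lambda>_. count_space UNIV"
    by (rule Ionescu_Tulcea_path_kernel)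
  have "emeasure PF.lim (space PF.lim) = emeasure (CI {}) (space (CI {}))"
    using lim[of "{}" "space (PiM {} (\<lambda>_. count_space UNIV))"]
    by (simp add: PF.space_P PF.space_lim prod_emb_def vimage_def space_PiM sets_PiM_count_space
        restrict_def)
  then show ?thesis
    unfolding path_measure_def
    using prob_space.emeasure_space_1[OF PF.prob_space_P[of "{}"]] by (intro prob_spaceI) simp
qed

lemma space_path_measure [simp]: "space (path_measure G \<pi>1 \<pi>2 v) = UNIV"
  using sets_eq_imp_space_eq[OF sets_path_measure] by (simp add: space_PiM)

lemma measurable_vertex [measurable]:
  "(\<lambda>\<omega>. \<omega> k) \<in> measurable (path_measure G \<pi>1 \<pi>2 v) (count_space UNIV)"
  by (simp add: measurable_cong_sets[OF sets_path_measure refl])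

lemma sets_prefix [measurable]:
  "{\<omega>. map \<omega> [0..<n] = xs} \<in> sets (path_measure G \<pi>1 \<pi>2 (v :: 'v::finite))"
proof -
  have eq: "{\<omega>. map \<omega> [0..<n] = xs} =
      {\<omega> \<in> space (path_measure G \<pi>1 \<pi>2 v). length xs = n \<and> (\<forall>i<n. \<omega> i = xs ! i)}"
    by (auto simp: list_eq_iff_nth_eq)
  show ?thesis unfolding eq by measurable
qed

lemma measurable_prefix [measurable]:
  "(\<lambda>\<omega>. map \<omega> [0..<n]) \<in>
    measurable (path_measure G \<pi>1 \<pi>2 (v :: 'v::finite)) (count_space UNIV)"
proof -
  have "(\<lambda>\<omega>. map \<omega> [0..<n]) -` {xs} \<inter> space (path_measure G \<pi>1 \<pi>2 v) =
      {\<omega>. map \<omega> [0..<n] = xs}" for xs by auto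
  then show ?thesis
    by (subst measurable_count_space_eq_countable) (simp_all only: sets_prefix, simp_all)
qed

lemma emeasure_prefix_snoc:
  assumes "length xs = Suc n"
  shows "emeasure (path_measure G \<pi>1 \<pi>2 v) {\<omega>. map \<omega> [0..<Suc (Suc n)] = xs @ [y]} =
    emeasure (path_measure G \<pi>1 \<pi>2 v) {\<omega>. map \<omega> [0..<Suc n] = xs} *
    ennreal (pmf (next_vertex G \<pi>1 \<pi>2 xs) y)"
proof -
  \<comment> \<open>The cylinder formula speaks of infinite sequences, so the list is read as one.
    Values of \<open>w\<close> beyond position \<open>Suc n\<close> are arbitrary and never
    enter.\<close>
  define w where "w i = (xs @ [y]) ! i" for i
  have pre: "map w [0..<Suc n] = xs"
    using assms by (intro nth_equalityI) (auto simp: w_def nth_append simp del: upt_Suc)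
  have ws: "w (Suc n) = y" using assms by (simp add: w_def nth_append)
  have 1: "{\<omega>. map \<omega> [0..<Suc n] = xs} = {\<omega>. \<forall>i\<le>n. \<omega> i = w i}"
    unfolding pre[symmetric] by (auto simp: map_eq_conv less_Suc_eq_le simp del: upt_Suc)
  have "xs @ [y] = map w [0..<Suc (Suc n)]" using pre ws by simp
  then have 2: "{\<omega>. map \<omega> [0..<Suc (Suc n)] = xs @ [y]} = {\<omega>. \<forall>i\<le>Suc n. \<omega> i = w i}"
    by (auto simp: map_eq_conv less_Suc_eq_le simp del: upt_Suc)
  show ?thesis
    unfolding 1 2 emeasure_path_measure_cylinder prod.lessThan_Suc pre ws
    by (simp add: mult.assoc)
qed

lemma nn_integral_prefix:
  fixes G :: "('v::finite, 'x) stochastic_game_scheme"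
  shows "(\<integral>\<^sup>+\<omega>. F (map \<omega> [0..<n]) \<partial>path_measure G \<pi>1 \<pi>2 v) =
    (\<Sum>xs | length xs = n. F xs * emeasure (path_measure G \<pi>1 \<pi>2 v) {\<omega>. map \<omega> [0..<n] = xs})"
proof -
  have fin: "finite {xs :: 'v list. length xs = n}"
    using finite_lists_length_eq[of "UNIV :: 'v set" n] by simp
  have "F (map \<omega> [0..<n]) =
      (\<Sum>xs | length xs = n. F xs * indicator {\<omega>. map \<omega> [0..<n] = xs} \<omega>)" for \<omega> :: "nat \<Rightarrow> 'v"
  proof -
    have "(\<Sum>xs | length xs = n. F xs * indicator {\<omega>. map \<omega> [0..<n] = xs} \<omega>) =
        (\<Sum>xs | length xs = n. if xs = map \<omega> [0..<n] then F xs else 0)"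
      by (intro sum.cong) (auto simp: indicator_def)
    then show ?thesis using fin by simp
  qed
  then show ?thesis
    by (simp add: nn_integral_sum nn_integral_cmult_indicator sets_prefix)
qed

text \<open>The tower property: a list of length \<open>n + 2\<close> splits uniquely into a history
  and a last vertex, and its cylinder probability factors accordingly. The inner expectation depends
  on the whole history because strategies may; histories are nonempty because the initial vertex has
  its own kernel.\<close>

lemma nn_integral_prefix_Suc:
  fixes G :: "('v::finite, 'x) stochastic_game_scheme"
  shows "(\<integral>\<^sup>+\<omega>. F (map \<omega> [0..<Suc (Suc n)]) \<partial>path_measure G \<pi>1 \<pi>2 v) =
    (\<integral>\<^sup>+\<omega>. (\<integral>\<^sup>+y. F (map \<omega> [0..<Suc n] @ [y]) \<partial>next_vertex G \<pi>1 \<pi>2 (map \<omega> [0..<Suc n]))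
      \<partial>path_measure G \<pi>1 \<pi>2 v)"
proof -
  let ?P = "path_measure G \<pi>1 \<pi>2 v"
  have bij: "bij_betw (\<lambda>(xs, y). xs @ [y]) ({xs :: 'v list. length xs = Suc n} \<times> UNIV)
      {xs. length xs = Suc (Suc n)}"
    by (rule bij_betw_byWitness[where f' = "\<lambda>xs. (butlast xs, last xs)"])
       (auto intro!: append_butlast_last_id)
  have "(\<integral>\<^sup>+\<omega>. F (map \<omega> [0..<Suc (Suc n)]) \<partial>?P) =
      (\<Sum>(xs, y) \<in> {xs. length xs = Suc n} \<times> UNIV.
        F (xs @ [y]) * emeasure ?P {\<omega>. map \<omega> [0..<Suc (Suc n)] = xs @ [y]})"
    unfolding nn_integral_prefix
    by (subst sum.reindex_bij_betw[OF bij, symmetric]) (simp add: case_prod_unfold del: upt_Suc)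
  also have "\<dots> = (\<Sum>xs | length xs = Suc n. \<Sum>y\<in>UNIV.
        F (xs @ [y]) * (emeasure ?P {\<omega>. map \<omega> [0..<Suc n] = xs} *
        ennreal (pmf (next_vertex G \<pi>1 \<pi>2 xs) y)))"
    unfolding sum.cartesian_product[symmetric]
    by (intro sum.cong refl) (simp only: mem_Collect_eq emeasure_prefix_snoc)
  also have "\<dots> = (\<Sum>xs | length xs = Suc n.
        (\<integral>\<^sup>+y. F (xs @ [y]) \<partial>next_vertex G \<pi>1 \<pi>2 xs) * emeasure ?P {\<omega>. map \<omega> [0..<Suc n] = xs})"
    by (intro sum.cong refl)
       (simp add: nn_integral_measure_pmf nn_integral_count_space_finite sum_distrib_right mult_ac)
  finally show ?thesis unfolding nn_integral_prefix[symmetric] .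
qed

lemma AE_path_start: "AE \<omega> in path_measure G \<pi>1 \<pi>2 v. \<omega> 0 = v"
proof -
  interpret prob_space "path_measure G \<pi>1 \<pi>2 v" by (rule prob_space_path_measure)
  have "emeasure (path_measure G \<pi>1 \<pi>2 v) {\<omega>. \<omega> 0 = v} = 1"
    using emeasure_path_measure_cylinder[of G \<pi>1 \<pi>2 v 0 "\<lambda>_. v"] by simp
  then show ?thesis using AE_prob_1[of "{\<omega>. \<omega> 0 = v}"] by (simp add: measure_def)
qed

lemma AE_path_step:
  "AE \<omega> in path_measure G \<pi>1 \<pi>2 v.
    \<forall>n. \<omega> (Suc n) \<in> set_pmf (next_vertex G \<pi>1 \<pi>2 (map \<omega> [0..<Suc n]))"
proof -
  have "AE \<omega> in path_measure G \<pi>1 \<pi>2 v.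
      \<omega> (Suc n) \<in> set_pmf (next_vertex G \<pi>1 \<pi>2 (map \<omega> [0..<Suc n]))" for n
  proof -
    \<comment> \<open>\<open>F\<close> indicates that the last step lies outside the support. Given
      any history its expectation is 0, so the tower property makes it vanish almost surely.\<close>
    define F :: "'a list \<Rightarrow> ennreal" where
      "F xs = (if last xs \<in> set_pmf (next_vertex G \<pi>1 \<pi>2 (butlast xs)) then 0 else 1)" for xs
    have "(\<integral>\<^sup>+y. F (xs @ [y]) \<partial>next_vertex G \<pi>1 \<pi>2 xs) = 0" for xs
      by (subst nn_integral_0_iff_AE) (auto simp: F_def AE_measure_pmf_iff)
    then have 0: "(\<integral>\<^sup>+\<omega>. F (map \<omega> [0..<Suc (Suc n)]) \<partial>path_measure G \<pi>1 \<pi>2 v) = 0"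
      unfolding nn_integral_prefix_Suc by (simp del: upt_Suc)
    have "(\<lambda>\<omega>. F (map \<omega> [0..<Suc (Suc n)])) \<in> borel_measurable (path_measure G \<pi>1 \<pi>2 v)"
      by (rule measurable_compose[OF measurable_prefix]) simp
    from 0[unfolded nn_integral_0_iff_AE[OF this]] show ?thesis
      by eventually_elim (simp add: F_def butlast_append split: if_split_asm)
  qed
  then show ?thesis by (simp add: AE_all_countable del: upt_Suc)
qed

lemma nn_integral_vertex_0:
  "(\<integral>\<^sup>+\<omega>. f (\<omega> 0) \<partial>path_measure G \<pi>1 \<pi>2 v) = f v"
proof -
  interpret prob_space "path_measure G \<pi>1 \<pi>2 v" by (rule prob_space_path_measure)
  have "(\<integral>\<^sup>+\<omega>. f (\<omega> 0) \<partial>path_measure G \<pi>1 \<pi>2 v) = (\<integral>\<^sup>+\<omega>. f v \<partial>path_measure G \<pi>1 \<pi>2 v)"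
    using AE_path_start[of v G \<pi>1 \<pi>2] by (intro nn_integral_cong_AE) auto
  then show ?thesis by (simp add: emeasure_space_1[unfolded space_path_measure])
qed

lemma nn_integral_vertex_Suc:
  "(\<integral>\<^sup>+\<omega>. f (\<omega> (Suc n)) \<partial>path_measure G \<pi>1 \<pi>2 v) =
    (\<integral>\<^sup>+\<omega>. (\<integral>\<^sup>+y. f y \<partial>next_vertex G \<pi>1 \<pi>2 (map \<omega> [0..<Suc n])) \<partial>path_measure G \<pi>1 \<pi>2 v)"
  using nn_integral_prefix_Suc[where F = "\<lambda>xs. f (last xs)"] by simp

lemma measurable_vertex_fun [measurable]:
  fixes f :: "'v::finite \<Rightarrow> ennreal"
  shows "(\<lambda>\<omega>. f (\<omega> n)) \<in> borel_measurable (path_measure G \<pi>1 \<pi>2 v)"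
  by (rule measurable_compose[OF measurable_vertex]) simp

lemma nn_integral_vertex_add:
  "(\<integral>\<^sup>+\<omega>. c (\<omega> n) \<partial>path_measure G \<pi>1 \<pi>2 v) + (\<integral>\<^sup>+\<omega>. f (\<omega> (Suc n)) \<partial>path_measure G \<pi>1 \<pi>2 v) =
    (\<integral>\<^sup>+\<omega>. c (\<omega> n) + (\<integral>\<^sup>+y. f y \<partial>next_vertex G \<pi>1 \<pi>2 (map \<omega> [0..<Suc n]))
      \<partial>path_measure G \<pi>1 \<pi>2 v)"
  unfolding nn_integral_vertex_Suc
  by (rule nn_integral_add[symmetric, OF measurable_vertex_fun])
     (rule measurable_compose[OF measurable_prefix], simp)

section \<open>Supermartingale and submartingale bounds for accumulated cost\<close>

text \<open>The expected cost paid so far plus the expected potential never increases with time.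
  Dropping the potential and letting the horizon grow bounds the whole series. The condition is
  required per history, so arbitrary strategies are covered. It serves both for rewards and, with
  the indicator of nonterminal vertices as cost, for the time before termination.\<close>

lemma supermartingale_bound:
  assumes step: "\<And>xs. xs \<noteq> [] \<Longrightarrow>
    c (last xs) + (\<integral>\<^sup>+y. f y \<partial>next_vertex G \<pi>1 \<pi>2 xs) \<le> f (last xs)"
  shows "(\<integral>\<^sup>+\<omega>. (\<Sum>i. c (\<omega> i)) \<partial>path_measure G \<pi>1 \<pi>2 v) \<le> f v"
proof -
  let ?P = "path_measure G \<pi>1 \<pi>2 v"
  have bound: "(\<Sum>i<n. \<integral>\<^sup>+\<omega>. c (\<omega> i) \<partial>?P) + (\<integral>\<^sup>+\<omega>. f (\<omega> n) \<partial>?P) \<le> f v" for n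
  proof (induction n)
    case 0
    then show ?case by (simp add: nn_integral_vertex_0)
  next
    case (Suc n)
    have "(\<integral>\<^sup>+\<omega>. c (\<omega> n) \<partial>?P) + (\<integral>\<^sup>+\<omega>. f (\<omega> (Suc n)) \<partial>?P) \<le> (\<integral>\<^sup>+\<omega>. f (\<omega> n) \<partial>?P)"
      unfolding nn_integral_vertex_add
    proof (rule nn_integral_mono)
      fix \<omega>
      show "c (\<omega> n) + (\<integral>\<^sup>+y. f y \<partial>next_vertex G \<pi>1 \<pi>2 (map \<omega> [0..<Suc n])) \<le> f (\<omega> n)"
        using step[of "map \<omega> [0..<Suc n]"] by simp
    qed
    then show ?case using Suc.IH by (simp add: add.assoc) (meson add_left_mono order_trans)
  qed
  have "(\<Sum>i<n. \<integral>\<^sup>+\<omega>. c (\<omega> i) \<partial>?P) \<le> f v" for n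
    using bound[of n] by (meson add_increasing2 order_trans zero_le order_refl)
  then show ?thesis
    by (subst nn_integral_suminf) (auto simp: suminf_eq_SUP intro!: SUP_least)
qed

text \<open>Here the remaining potential cannot be dropped, so it stays as an error term. The cost
  part is already enlarged to the full series, which leaves this term as the only one depending on
  \<open>n\<close>; \<open>expectation_vanishes\<close> sends it to 0.\<close>

lemma submartingale_bound:
  assumes step: "\<And>xs. xs \<noteq> [] \<Longrightarrow>
    f (last xs) \<le> c (last xs) + (\<integral>\<^sup>+y. f y \<partial>next_vertex G \<pi>1 \<pi>2 xs)"
  shows "f v \<le> (\<integral>\<^sup>+\<omega>. (\<Sum>i. c (\<omega> i)) \<partial>path_measure G \<pi>1 \<pi>2 v) +
    (\<integral>\<^sup>+\<omega>. f (\<omega> n) \<partial>path_measure G \<pi>1 \<pi>2 v)"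
proof -
  let ?P = "path_measure G \<pi>1 \<pi>2 v"
  have "f v \<le> (\<Sum>i<n. \<integral>\<^sup>+\<omega>. c (\<omega> i) \<partial>?P) + (\<integral>\<^sup>+\<omega>. f (\<omega> n) \<partial>?P)"
  proof (induction n)
    case 0
    then show ?case by (simp add: nn_integral_vertex_0)
  next
    case (Suc n)
    have "(\<integral>\<^sup>+\<omega>. f (\<omega> n) \<partial>?P) \<le> (\<integral>\<^sup>+\<omega>. c (\<omega> n) \<partial>?P) + (\<integral>\<^sup>+\<omega>. f (\<omega> (Suc n)) \<partial>?P)"
      unfolding nn_integral_vertex_add
    proof (rule nn_integral_mono)
      fix \<omega>
      show "f (\<omega> n) \<le> c (\<omega> n) + (\<integral>\<^sup>+y. f y \<partial>next_vertex G \<pi>1 \<pi>2 (map \<omega> [0..<Suc n]))"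
        using step[of "map \<omega> [0..<Suc n]"] by simp
    qed
    then show ?case using Suc.IH by (simp add: add.assoc) (meson add_left_mono order_trans)
  qed
  also have "(\<Sum>i<n. \<integral>\<^sup>+\<omega>. c (\<omega> i) \<partial>?P) \<le> (\<integral>\<^sup>+\<omega>. (\<Sum>i. c (\<omega> i)) \<partial>?P)"
    by (subst nn_integral_suminf) (auto intro!: sum_le_suminf)
  finally show ?thesis by (simp add: add_right_mono)
qed

section \<open>Supports of moves, absorption in terminal vertices and fair plays\<close>

lemma pmf_embed_delta:
  assumes "stochastic_game G" "v \<in> VP G"
  shows "pmf (embed_pmf (delta G v)) u = delta G v u"
proof -
  have "v \<notin> V1 G" "v \<notin> V2 G" using assms by (auto simp: stochastic_game_def)
  then show ?thesis
    using assms pmf_next_vertex_probabilistic[of G "[v]" undefined undefined u]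
    by (simp add: next_vertex_def)
qed

lemma set_pmf_embed_delta:
  assumes "stochastic_game G" "v \<in> VP G"
  shows "set_pmf (embed_pmf (delta G v)) = post G v"
  using assms pmf_embed_delta[OF assms]
  by (auto simp: set_pmf_iff post_def stochastic_game_def less_le)

lemma strategy_support:
  assumes "\<pi> \<in> strategies G U" "xs \<noteq> []" "last xs \<in> U"
  shows "set_pmf (\<pi> xs) \<subseteq> post G (last xs)"
proof
  fix u assume "u \<in> set_pmf (\<pi> xs)"
  then have "0 < pmf (\<pi> xs) u" by (rule pmf_positive)
  then have "0 < pmf (\<pi> (butlast xs @ [last xs])) u"
    by (simp only: append_butlast_last_id[OF assms(2)])
  with assms(3) show "u \<in> post G (last xs)"
    by (rule assms(1)[unfolded strategies_def, THEN CollectD, rule_format])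
qed

lemma probabilistic_vertex:
  assumes "stochastic_game G" "v \<notin> V1 G" "v \<notin> V2 G"
  shows "v \<in> VP G"
proof -
  have "V1 G \<union> V2 G \<union> VP G = UNIV" using assms(1) by (simp add: stochastic_game_def)
  then show ?thesis using assms(2,3) by blast
qed

lemma set_pmf_next_vertex:
  assumes "stochastic_game G" "\<pi>1 \<in> strategies1 G" "\<pi>2 \<in> strategies2 G" "xs \<noteq> []"
  shows "set_pmf (next_vertex G \<pi>1 \<pi>2 xs) \<subseteq> post G (last xs)"
  using strategy_support[of \<pi>1 G "V1 G" xs] strategy_support[of \<pi>2 G "V2 G" xs]
    set_pmf_embed_delta[OF assms(1), of "last xs"] probabilistic_vertex[OF assms(1), of "last xs"] assms(2-)
  by (simp add: next_vertex_def strategies1_def strategies2_def)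

lemma AE_paths:
  assumes "stochastic_game G" "\<pi>1 \<in> strategies1 G" "\<pi>2 \<in> strategies2 G"
  shows "AE \<omega> in path_measure G \<pi>1 \<pi>2 v. \<omega> \<in> paths G"
  using AE_path_step
proof eventually_elim
  case (elim \<omega>)
  then have "\<omega> (Suc n) \<in> post G (\<omega> n)" for n
    using set_pmf_next_vertex[OF assms, of "map \<omega> [0..<Suc n]"] by auto
  then show ?case by (auto simp: paths_def post_def)
qed

lemma post_terminal: "v \<in> terminal G \<Longrightarrow> post G v = {v}"
  by (force simp: terminal_def post_def)

lemma paths_step: "\<omega> \<in> paths G \<Longrightarrow> \<omega> (Suc n) \<in> post G (\<omega> n)"
  by (simp add: paths_def post_def)

lemma paths_terminal_absorbing:
  assumes "\<omega> \<in> paths G" "\<omega> k \<in> terminal G" "k \<le> n"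
  shows "\<omega> n = \<omega> k"
  using assms(3)
proof (induction n rule: dec_induct)
  case (step n)
  have "\<omega> (Suc n) \<in> post G (\<omega> k)" using paths_step[OF assms(1), of n] step.IH by simp
  then show ?case unfolding post_terminal[OF assms(2)] by simp
qed simp

text \<open>The play is frozen from position \<open>k\<close> on, so its only recurrent vertex is
  its own only successor. Hence almost sure termination implies fairness.\<close>

lemma visiting_terminal_fair:
  assumes "\<omega> \<in> paths G" "\<omega> k \<in> terminal G"
  shows "\<omega> \<in> fair_paths2 G"
proof -
  have iff: "a \<in> inf_visited \<omega> \<longleftrightarrow> (\<forall>m. \<exists>n\<ge>m. \<omega> n = a)" for a
    by (simp add: inf_visited_def INFM_nat_le)
  have "inf_visited \<omega> = {\<omega> k}"
  proof (intro set_eqI iffI)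
    fix a assume "a \<in> inf_visited \<omega>"
    then obtain n where n: "n \<ge> k" "\<omega> n = a" by (meson iff)
    show "a \<in> {\<omega> k}" using paths_terminal_absorbing[OF assms n(1)] n(2) by simp
  next
    fix a assume a: "a \<in> {\<omega> k}"
    have "max m k \<ge> m \<and> \<omega> (max m k) = a" for m
      using paths_terminal_absorbing[OF assms, of "max m k"] a by simp
    then show "a \<in> inf_visited \<omega>" unfolding iff by (intro allI exI)
  qed
  moreover have "post G (\<omega> k) \<subseteq> {\<omega> k}" using post_terminal[OF assms(2)] by simp
  ultimately show ?thesis
    unfolding fair_paths2_def using assms(1) by (intro CollectI conjI ballI impI) simp_all
qed

lemma sets_fair_paths2 [measurable]:
  "fair_paths2 G \<in> sets (path_measure H \<pi>1 \<pi>2 (v :: 'v::finite))"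
proof -
  let ?P = "path_measure H \<pi>1 \<pi>2 v"
  have at [measurable]: "Measurable.pred ?P (\<lambda>\<omega>. \<omega> i = a)" for i a
    by (rule measurable_compose[OF measurable_vertex]) simp
  \<comment> \<open>The edge condition becomes a finite disjunction over pairs of vertices, each
    disjunct being an event about two coordinates.\<close>
  have step: "Measurable.pred ?P (\<lambda>\<omega>. \<exists>(a, b)\<in>{(a, b). 0 < delta G a b}. \<omega> i = a \<and> \<omega> (Suc i) = b)" for i
    unfolding case_prod_unfold by (intro pred_intros_finite pred_intros_logic at) simp
  have inf: "Measurable.pred ?P (\<lambda>\<omega>. a \<in> inf_visited \<omega>)" for a
    unfolding inf_visited_def INFM_nat_le mem_Collect_eq
    by (intro pred_intros_countable pred_intros_logic at) auto
  have "fair_paths2 G = {\<omega> \<in> space ?P.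
      (\<forall>k. \<exists>(a, b)\<in>{(a, b). 0 < delta G a b}. \<omega> k = a \<and> \<omega> (Suc k) = b) \<and>
      (\<forall>a\<in>V2 G. a \<in> inf_visited \<omega> \<longrightarrow> (\<forall>b\<in>post G a. b \<in> inf_visited \<omega>))}"
    by (auto simp: fair_paths2_def paths_def)
  also have "\<dots> \<in> sets ?P"
    unfolding pred_def[symmetric]
    by (intro pred_intros_countable pred_intros_finite pred_intros_logic step inf) auto
  finally show ?thesis .
qed

lemma nn_integral_pmf_const_support:
  assumes "set_pmf p \<subseteq> {a}"
  shows "(\<integral>\<^sup>+u. f u \<partial>measure_pmf p) = f a"
proof -
  have "(\<integral>\<^sup>+u. f u \<partial>measure_pmf p) = (\<integral>\<^sup>+u. f a \<partial>measure_pmf p)"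
    using assms by (intro nn_integral_cong_AE) (auto simp: AE_measure_pmf_iff)
  then show ?thesis by simp
qed

section \<open>Positional strategies and properness\<close>

definition positional :: "('v \<Rightarrow> 'v) \<Rightarrow> 'v strategy" where
  "positional d xs = return_pmf (d (last xs))"

lemma positional_strategies:
  assumes "\<And>v. v \<in> U \<Longrightarrow> d v \<in> post G v"
  shows "positional d \<in> strategies G U"
  using assms by (auto simp: strategies_def positional_def indicator_def split: if_split_asm)

lemma memoryless_on_positional: "memoryless_on U (positional d)"
  by (simp add: memoryless_on_def positional_def)

text \<open>The successor distributions Player 1 can choose from when Player 2 always plays \<open>d\<close>.\<close>

definition moves :: "('v::finite, 'x) stochastic_game_scheme \<Rightarrow> ('v \<Rightarrow> 'v) \<Rightarrow> 'v \<Rightarrow> 'v pmf set" where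
  "moves G d v =
     (if v \<in> V1 G then return_pmf ` post G v
      else if v \<in> V2 G then {return_pmf (d v)}
      else {embed_pmf (delta G v)})"

lemma finite_moves: "finite (moves G d v)"
  by (simp add: moves_def)

lemma moves_nonempty: "stochastic_game G \<Longrightarrow> moves G d v \<noteq> {}"
  by (simp add: moves_def stochastic_game_def)

lemma moves_fun_upd: "v \<noteq> a \<or> v \<notin> V2 G \<Longrightarrow> moves G (d(a := u)) v = moves G d v"
  by (auto simp: moves_def)

lemma set_pmf_moves:
  assumes "stochastic_game G" "\<And>v. v \<in> V2 G \<Longrightarrow> d v \<in> post G v" "p \<in> moves G d v"
  shows "set_pmf p \<subseteq> post G v"
  using assms(2)[of v] assms(3) set_pmf_embed_delta[OF assms(1), of v] probabilistic_vertex[OF assms(1), of v]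
  by (auto simp: moves_def split: if_split_asm)

text \<open>A randomised choice of Player 1 averages over pure successors, so a bound for each pure
  move carries over to the average. This reduces arbitrary Player 1 strategies to the finite sets
  \<open>moves\<close>.\<close>

lemma nn_integral_next_positional_le:
  assumes "\<pi>1 \<in> strategies1 G" "xs \<noteq> []"
    and "\<And>p. p \<in> moves G d (last xs) \<Longrightarrow> c + (\<integral>\<^sup>+u. f u \<partial>p) \<le> b"
  shows "c + (\<integral>\<^sup>+u. f u \<partial>next_vertex G \<pi>1 (positional d) xs) \<le> b"
proof (cases "last xs \<in> V1 G")
  case True
  have post: "set_pmf (\<pi>1 xs) \<subseteq> post G (last xs)"
    using strategy_support[of \<pi>1 G "V1 G" xs] assms(1,2) True by (simp add: strategies1_def)
  have le: "c + f u \<le> b" if "u \<in> post G (last xs)" for u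
    using assms(3)[of "return_pmf u"] that True by (simp add: moves_def)
  have "c + (\<integral>\<^sup>+u. f u \<partial>\<pi>1 xs) = (\<integral>\<^sup>+u. c + f u \<partial>\<pi>1 xs)"
    by (simp add: nn_integral_add)
  also have "\<dots> \<le> (\<integral>\<^sup>+u. b \<partial>\<pi>1 xs)"
    using post le by (intro nn_integral_mono_AE) (auto simp: AE_measure_pmf_iff)
  finally show ?thesis using True by (simp add: next_vertex_def)
next
  case False
  then show ?thesis
    using assms(3) by (simp add: next_vertex_def positional_def moves_def)
qed

text \<open>Finiteness is the real demand: the constant \<top> always satisfies the inequalities.
  They make \<open>w v\<close> a bound on the expected number of nonterminal positions of a play
  from \<open>v\<close>.\<close>

definition lyapunov :: "('v::finite, 'x) stochastic_game_scheme \<Rightarrow> ('v \<Rightarrow> 'v) \<Rightarrow> ('v \<Rightarrow> ennreal) \<Rightarrow> bool" where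
  "lyapunov G d w \<longleftrightarrow> (\<forall>v. w v < \<top>) \<and>
     (\<forall>v. \<forall>p\<in>moves G d v. indicator (- terminal G) v + (\<integral>\<^sup>+u. w u \<partial>p) \<le> w v)"

text \<open>The proper policies of stochastic shortest path theory, with one bound valid against all
  replies of Player 1.\<close>

definition proper :: "('v::finite, 'x) stochastic_game_scheme \<Rightarrow> ('v \<Rightarrow> 'v) \<Rightarrow> bool" where
  "proper G d \<longleftrightarrow> (\<forall>v\<in>V2 G. d v \<in> post G v) \<and> (\<exists>w. lyapunov G d w)"

lemma properE:
  assumes "proper G d"
  obtains w where "\<And>v. w v < \<top>"
    "\<And>v p. p \<in> moves G d v \<Longrightarrow> indicator (- terminal G) v + (\<integral>\<^sup>+u. w u \<partial>p) \<le> w v"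
  using assms unfolding proper_def lyapunov_def by blast

lemma proper_memoryless_fair:
  assumes "stochastic_game G" "proper G d"
  shows "positional d \<in> memoryless_fair_strategies2 G"
proof -
  obtain w where w: "\<And>v. w v < \<top>"
    "\<And>v p. p \<in> moves G d v \<Longrightarrow> indicator (- terminal G) v + (\<integral>\<^sup>+u. w u \<partial>p) \<le> w v"
    using assms(2) by (rule properE) blast
  have s2: "positional d \<in> strategies2 G"
    unfolding strategies2_def using assms(2) by (intro positional_strategies) (simp add: proper_def)
  have "measure (path_measure G \<pi>1 (positional d) v) (fair_paths2 G) = 1"
    if s1: "\<pi>1 \<in> strategies1 G" for \<pi>1 v
  proof -
    let ?P = "path_measure G \<pi>1 (positional d) v"
    interpret prob_space ?P by (rule prob_space_path_measure)
    have "(\<integral>\<^sup>+\<omega>. (\<Sum>i. indicator (- terminal G) (\<omega> i)) \<partial>?P) \<le> w v"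
      by (rule supermartingale_bound) (intro nn_integral_next_positional_le s1 w(2))
    then have "(\<integral>\<^sup>+\<omega>. (\<Sum>i. indicator (- terminal G) (\<omega> i)) \<partial>?P) \<noteq> \<infinity>"
      using w(1)[of v] by auto
    then have "AE \<omega> in ?P. (\<Sum>i. indicator (- terminal G) (\<omega> i) :: ennreal) \<noteq> \<infinity>"
      by (intro nn_integral_noteq_infinite) auto
    then have "AE \<omega> in ?P. \<omega> \<in> fair_paths2 G"
      using AE_paths[OF assms(1) s1 s2, of v]
    proof eventually_elim
      case (elim \<omega>)
      have "\<exists>k. \<omega> k \<in> terminal G"
      proof (rule ccontr)
        assume "\<not> ?thesis"
        \<comment> \<open>A play that never terminates pays 1 at every position, which contradicts
          the finite sum.\<close>
        then have "(\<Sum>i. indicator (- terminal G) (\<omega> i)) = (\<Sum>i. 1 :: ennreal)" by simp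
        also have "\<dots> = \<top>" by (simp add: suminf_eq_SUP ennreal_SUP_of_nat_eq_top)
        finally show False using elim(1) by simp
      qed
      then show ?case using visiting_terminal_fair[OF elim(2)] by blast
    qed
    then show ?thesis using prob_eq_1[OF sets_fair_paths2] by blast
  qed
  then show ?thesis
    using s2 by (simp add: memoryless_fair_strategies2_def fair_strategies2_def memoryless_on_positional)
qed

section \<open>The best-response value against a positional strategy\<close>

definition bellman ::
    "('v::finite, 'x) reward_game_scheme \<Rightarrow> ('v \<Rightarrow> 'v) \<Rightarrow> ('v \<Rightarrow> ennreal) \<Rightarrow> 'v \<Rightarrow> ennreal" where
  "bellman G d f v = (SUP p\<in>moves G d v. ennreal (reward G v) + (\<integral>\<^sup>+u. f u \<partial>measure_pmf p))"

text \<open>The least fixed point is the relevant one: in a stochastic game, adding a constant to a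
  solution of the Bellman equation gives another solution.\<close>

definition response_value :: "('v::finite, 'x) reward_game_scheme \<Rightarrow> ('v \<Rightarrow> 'v) \<Rightarrow> 'v \<Rightarrow> ennreal" where
  "response_value G d = lfp (bellman G d)"

lemma mono_bellman: "mono (bellman G d)"
  by (auto simp: mono_def le_fun_def bellman_def intro!: SUP_mono' add_left_mono nn_integral_mono)

lemma response_value_unfold: "response_value G d v = bellman G d (response_value G d) v"
  using lfp_unfold[OF mono_bellman, of G d] by (metis response_value_def)

lemma response_value_le:
  assumes "\<And>v p. p \<in> moves G d v \<Longrightarrow> ennreal (reward G v) + (\<integral>\<^sup>+u. f u \<partial>p) \<le> f v"
  shows "response_value G d v \<le> f v"
proof -
  have "bellman G d f \<le> f" using assms by (auto simp: le_fun_def bellman_def intro!: SUP_least)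
  then show ?thesis unfolding response_value_def by (metis lfp_lowerbound le_funD)
qed

lemma response_value_ge:
  "p \<in> moves G d v \<Longrightarrow>
    ennreal (reward G v) + (\<integral>\<^sup>+u. response_value G d u \<partial>p) \<le> response_value G d v"
  by (subst (2) response_value_unfold) (auto simp: bellman_def intro: SUP_upper)

text \<open>There are only finitely many moves, so the supremum is a maximum. This later supplies
  the positional strategy of Player 1.\<close>

lemma response_value_attained:
  assumes "stochastic_game G"
  obtains p where "p \<in> moves G d v"
    "response_value G d v = ennreal (reward G v) + (\<integral>\<^sup>+u. response_value G d u \<partial>p)"
proof -
  let ?A = "(\<lambda>p. ennreal (reward G v) + (\<integral>\<^sup>+u. response_value G d u \<partial>measure_pmf p)) ` moves G d v"
  have "Sup ?A \<in> ?A"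
    using finite_moves moves_nonempty[OF assms]
    by (metis (no_types, lifting) Max_Sup Max_in finite_imageI image_is_empty)
  then show ?thesis using that response_value_unfold[of G d v] by (auto simp: bellman_def)
qed

lemma nn_integral_terminal_move:
  assumes "stochastic_game G" "proper G d" "v \<in> terminal G" "p \<in> moves G d v"
  shows "(\<integral>\<^sup>+u. f u \<partial>measure_pmf p) = f v"
  using set_pmf_moves[OF assms(1) _ assms(4)] assms(2) post_terminal[OF assms(3)]
  by (intro nn_integral_pmf_const_support) (auto simp: proper_def)

text \<open>Rewards are paid only off the terminal set and each is at most \<open>R\<close>, while
  \<open>w\<close> bounds the expected number of such payments. Hence \<open>R * w\<close> is a
  finite pre-fixed point above the least one.\<close>

lemma response_value_finite:
  assumes "reward_game G" "proper G d"
  shows "response_value G d v < \<top>"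
proof -
  obtain w where w: "\<And>v. w v < \<top>"
    "\<And>v p. p \<in> moves G d v \<Longrightarrow> indicator (- terminal G) v + (\<integral>\<^sup>+u. w u \<partial>p) \<le> w v"
    using assms(2) by (rule properE) blast
  define R where "R = (\<Sum>v\<in>UNIV. ennreal (reward G v))"
  have R: "ennreal (reward G v) \<le> R * indicator (- terminal G) v" for v
  proof (cases "v \<in> terminal G")
    case True
    then show ?thesis using assms(1) by (simp add: reward_game_def)
  next
    case False
    then show ?thesis using member_le_sum[of v UNIV "\<lambda>v. ennreal (reward G v)"] by (simp add: R_def)
  qed
  have "response_value G d v \<le> R * w v"
  proof (rule response_value_le)
    fix v p assume p: "p \<in> moves G d v"
    have "ennreal (reward G v) + (\<integral>\<^sup>+u. R * w u \<partial>p) \<le>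
        R * indicator (- terminal G) v + R * (\<integral>\<^sup>+u. w u \<partial>p)"
      using R[of v] by (simp add: nn_integral_cmult add_right_mono)
    also have "\<dots> = R * (indicator (- terminal G) v + (\<integral>\<^sup>+u. w u \<partial>p))"
      by (simp add: distrib_left)
    also have "\<dots> \<le> R * w v" by (intro mult_left_mono w(2) p) simp
    finally show "ennreal (reward G v) + (\<integral>\<^sup>+u. R * w u \<partial>p) \<le> R * w v" .
  qed
  also have "\<dots> < \<top>" using w(1)[of v] by (simp add: R_def ennreal_mult_less_top)
  finally show ?thesis .
qed

text \<open>Resetting the value to 0 on the terminal set again gives a pre-fixed point, since play
  stays put there without reward. Leastness then forces the value to be 0.\<close>

lemma response_value_terminal:
  assumes "reward_game G" "proper G d" "v \<in> terminal G"
  shows "response_value G d v = 0"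
proof -
  let ?f = "\<lambda>v. if v \<in> terminal G then 0 else response_value G d v"
  have "response_value G d v \<le> ?f v"
  proof (rule response_value_le)
    fix v p assume p: "p \<in> moves G d v"
    show "ennreal (reward G v) + (\<integral>\<^sup>+u. ?f u \<partial>p) \<le> ?f v"
    proof (cases "v \<in> terminal G")
      case True
      have "(\<integral>\<^sup>+u. ?f u \<partial>p) = ?f v"
        using assms(1) by (intro nn_integral_terminal_move[OF _ assms(2) True p]) (simp add: reward_game_def)
      then show ?thesis using True assms(1) by (simp add: reward_game_def)
    next
      case False
      have "(\<integral>\<^sup>+u. ?f u \<partial>p) \<le> (\<integral>\<^sup>+u. response_value G d u \<partial>p)" by (intro nn_integral_mono) simp
      then have "ennreal (reward G v) + (\<integral>\<^sup>+u. ?f u \<partial>p) \<le> response_value G d v"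
        using response_value_ge[OF p] by (meson add_left_mono order_trans)
      then show ?thesis using False by simp
    qed
  qed
  then show ?thesis using assms(3) by simp
qed

lemma expected_reward_positional_le:
  assumes "\<pi>1 \<in> strategies1 G"
  shows "expected_reward G \<pi>1 (positional d) v \<le> response_value G d v"
  unfolding expected_reward_def total_reward_def
  by (rule supermartingale_bound[where c = "\<lambda>v. ennreal (reward G v)"])
     (intro nn_integral_next_positional_le assms response_value_ge)

section \<open>Policy improvement and an optimal proper strategy\<close>

lemma ennreal_mult_gap:
  fixes a b c x :: ennreal
  assumes "a < b" "b < \<top>" "c < \<top>"
  obtains M where "M < \<top>" "c + M * a \<le> M * b"
proof -
  define a' b' c' where "a' = enn2real a" and "b' = enn2real b" and "c' = enn2real c"
  have "a < \<top>" using assms by order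
  then have eq: "a = ennreal a'" "b = ennreal b'" "c = ennreal c'"
    and nn: "0 \<le> a'" "0 \<le> b'" "0 \<le> c'"
    using assms(2,3) by (simp_all add: a'_def b'_def c'_def)
  have lt: "a' < b'" using assms(1) nn by (simp add: eq ennreal_less_iff)
  \<comment> \<open>The solution of \<open>c' + M * a' = M * b'\<close>, available because the gap
    \<open>b' - a'\<close> is positive.\<close>
  define M where "M = c' / (b' - a')"
  have M: "0 \<le> M" "c' + M * a' = M * b'" using lt nn by (auto simp: M_def field_simps)
  have "c + ennreal M * a = ennreal M * b"
    using M nn by (simp add: eq ennreal_mult[symmetric] ennreal_plus[symmetric] del: ennreal_plus)
  then show ?thesis by (intro that[of "ennreal M"]) simp_all
qed

text \<open>If \<open>w\<close> is a Lyapunov function for \<open>d\<close> and \<open>h\<close> the value of \<open>d\<close>, then \<open>w + M h\<close> is one for the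
  improved strategy: the strict decrease of \<open>h\<close> at \<open>a\<close>, scaled by a large \<open>M\<close>, pays for any increase
  of \<open>w\<close> there, while elsewhere \<open>h\<close> does not increase in expectation.\<close>

lemma proper_improve:
  fixes a :: "'v::finite"
  assumes G: "reward_game G" and d: "proper G d" and a: "a \<in> V2 G" "u \<in> post G a"
    and less: "ennreal (reward G a) + response_value G d u < response_value G d a"
  shows "proper G (d(a := u))"
proof -
  let ?h = "response_value G d"
  have a1: "a \<notin> V1 G" using G a(1) by (auto simp: reward_game_def stochastic_game_def)
  obtain w where w: "\<And>v. w v < \<top>"
    "\<And>v p. p \<in> moves G d v \<Longrightarrow> indicator (- terminal G) v + (\<integral>\<^sup>+u. w u \<partial>p) \<le> w v"
    using d by (rule properE) blast
  have "?h u \<le> ennreal (reward G a) + ?h u" by simp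
  then have gap: "?h u < ?h a" using less by (rule le_less_trans)
  \<comment> \<open>The constant \<open>1 + w u\<close> covers the unit cost of the step and the old
    potential at the new successor.\<close>
  obtain M where M: "M < \<top>" "1 + w u + M * ?h u \<le> M * ?h a"
  proof (rule ennreal_mult_gap[OF gap response_value_finite[OF G d]])
    show "1 + w u < \<top>" using w(1)[of u] by simp
  qed
  define w' where "w' v = w v + M * ?h v" for v
  have "indicator (- terminal G) v + (\<integral>\<^sup>+u. w' u \<partial>p) \<le> w' v" if p: "p \<in> moves G (d(a := u)) v" for v p
  proof (cases "v = a")
    case True
    then have "p = return_pmf u" using p a a1 by (simp add: moves_def)
    then have "indicator (- terminal G) v + (\<integral>\<^sup>+u. w' u \<partial>p) \<le> 1 + w u + M * ?h u"
      by (simp add: w'_def indicator_def add.assoc)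
    also have "\<dots> \<le> w' v" using M(2) True by (simp add: w'_def add_increasing)
    finally show ?thesis .
  next
    case False
    then have p: "p \<in> moves G d v" using p by (simp add: moves_fun_upd)
    have "(\<integral>\<^sup>+u. ?h u \<partial>p) \<le> ?h v"
      by (rule order_trans[OF _ response_value_ge[OF p]]) simp
    then have "(indicator (- terminal G) v + (\<integral>\<^sup>+u. w u \<partial>p)) + M * (\<integral>\<^sup>+u. ?h u \<partial>p) \<le> w v + M * ?h v"
      by (intro add_mono w(2) p mult_left_mono) simp_all
    then show ?thesis by (simp add: w'_def nn_integral_add nn_integral_cmult add.assoc)
  qed
  moreover have "w' v < \<top>" for v
    using w(1)[of v] M(1) response_value_finite[OF G d, of v] by (simp add: w'_def ennreal_mult_less_top)
  ultimately have "lyapunov G (d(a := u)) w'" by (simp add: lyapunov_def)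
  then show ?thesis using d a(2) by (auto simp: proper_def)
qed

text \<open>Only the move at \<open>a\<close> changes, and there the deviation is profitable, so the
  old value is a pre-fixed point for the new strategy. Unfolding the new value once at
  \<open>a\<close> makes the drop strict.\<close>

lemma response_value_improve:
  fixes a :: "'v::finite"
  assumes G: "reward_game G" and a: "a \<in> V2 G"
    and less: "ennreal (reward G a) + response_value G d u < response_value G d a"
  shows "response_value G (d(a := u)) v \<le> response_value G d v"
    and "response_value G (d(a := u)) a < response_value G d a"
proof -
  let ?d = "d(a := u)"
  have moves_a: "moves G ?d a = {return_pmf u}"
    using G a by (auto simp: moves_def reward_game_def stochastic_game_def)
  show le: "response_value G ?d v \<le> response_value G d v" for v
  proof (rule response_value_le)
    fix v p assume p: "p \<in> moves G ?d v"
    show "ennreal (reward G v) + (\<integral>\<^sup>+u. response_value G d u \<partial>p) \<le> response_value G d v"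
      using p moves_a less response_value_ge[of p G d v] moves_fun_upd[of v a G d u]
      by (cases "v = a") (auto intro: less_imp_le)
  qed
  have "response_value G ?d a = ennreal (reward G a) + response_value G ?d u"
    by (subst response_value_unfold) (simp add: bellman_def moves_a)
  also have "\<dots> \<le> ennreal (reward G a) + response_value G d u" by (intro add_left_mono le)
  finally show "response_value G ?d a < response_value G d a" using less by simp
qed

lemma optimal_proper_exists:
  fixes G :: "('v::finite, 'x) reward_game_scheme"
  assumes G: "reward_game G" and "proper G d0"
  obtains d where "proper G d"
    "\<And>v u. v \<in> V2 G \<Longrightarrow> u \<in> post G v \<Longrightarrow>
      response_value G d v \<le> ennreal (reward G v) + response_value G d u"
proof -
  let ?S = "\<lambda>d. \<Sum>v\<in>UNIV. response_value G d v"
  \<comment> \<open>A finite vertex type admits only finitely many maps \<open>d\<close>, so a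
    minimal sum is attained. The sum drops strictly when one entry drops and no entry rises.\<close>
  obtain d where d: "proper G d" and min: "\<And>d'. proper G d' \<Longrightarrow> ?S d \<le> ?S d'"
    using ex_min_if_finite[of "?S ` {d. proper G d}"] assms(2) by (auto simp: not_less)
  have "response_value G d v \<le> ennreal (reward G v) + response_value G d u"
    if v: "v \<in> V2 G" "u \<in> post G v" for v u
  proof (rule ccontr)
    let ?d = "d(v := u)"
    assume "\<not> ?thesis"
    then have less: "ennreal (reward G v) + response_value G d u < response_value G d v" by simp
    \<comment> \<open>Strict inequality survives adding the remaining entries only because their sum
      is finite.\<close>
    have "response_value G ?d i \<noteq> \<top>" for i
      using response_value_finite[OF G proper_improve[OF G d v less], of i] by simp
    then have fin: "(\<Sum>v\<in>UNIV - {v}. response_value G ?d v) \<noteq> \<top>" by simp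
    have "?S ?d = (\<Sum>v\<in>UNIV - {v}. response_value G ?d v) + response_value G ?d v"
      by (simp add: sum.remove[of UNIV v] add.commute)
    also have "\<dots> < (\<Sum>v\<in>UNIV - {v}. response_value G ?d v) + response_value G d v"
      using fin response_value_improve(2)[OF G v(1) less]
      by (simp add: ennreal_add_left_cancel_less)
    also have "\<dots> \<le> (\<Sum>v\<in>UNIV - {v}. response_value G d v) + response_value G d v"
      by (intro add_right_mono sum_mono response_value_improve(1)[OF G v(1) less])
    also have "\<dots> = ?S d" by (simp add: sum.remove[of UNIV v] add.commute)
    finally show False using min[OF proper_improve[OF G d v less]] by simp
  qed
  then show ?thesis using that d by blast
qed

section \<open>Existence of a proper strategy\<close>

lemma AE_visiting:
  assumes "stopping_under_fairness G" "\<pi>1 \<in> strategies1 G" "\<pi>2 \<in> fair_strategies2 G"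
  shows "AE \<omega> in path_measure G \<pi>1 \<pi>2 v. \<omega> \<in> visiting G (terminal G)"
proof -
  interpret prob_space "path_measure G \<pi>1 \<pi>2 v" by (rule prob_space_path_measure)
  show ?thesis using assms by (intro AE_prob_1) (simp add: stopping_under_fairness_def)
qed

text \<open>Player 1 can always choose to stay in \<open>C\<close>, and all other vertices of
  \<open>C\<close> lead only into \<open>C\<close>. The play would then avoid the terminal set
  surely, although it must terminate almost surely against the fair \<open>\<pi>2\<close>.\<close>

lemma no_trap:
  assumes G: "stochastic_game G" and stop: "stopping_under_fairness G"
    and fair: "\<pi>2 \<in> fair_strategies2 G"
    and C: "C \<inter> terminal G = {}" "v \<in> C"
    and stay1: "\<And>v. v \<in> C \<Longrightarrow> v \<in> V1 G \<Longrightarrow> post G v \<inter> C \<noteq> {}"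
    and stay2: "\<And>v. v \<in> C \<Longrightarrow> v \<notin> V1 G \<Longrightarrow> post G v \<subseteq> C"
  shows False
proof -
  \<comment> \<open>Off \<open>C\<close> any legal successor will do; it is chosen only to make
    \<open>e\<close> a strategy at every Player 1 vertex.\<close>
  define e where "e v = (if v \<in> C then SOME u. u \<in> post G v \<inter> C else SOME u. u \<in> post G v)" for v
  have e: "e v \<in> post G v" "v \<in> C \<Longrightarrow> e v \<in> C" if "v \<in> V1 G" for v
    using G stay1[OF _ that] some_in_eq[of "post G v \<inter> C"] some_in_eq[of "post G v"]
    by (auto simp: e_def stochastic_game_def)
  have s1: "positional e \<in> strategies1 G"
    unfolding strategies1_def using e(1) by (rule positional_strategies)
  have s2: "\<pi>2 \<in> strategies2 G" using fair by (simp add: fair_strategies2_def)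
  interpret prob_space "path_measure G (positional e) \<pi>2 v" by (rule prob_space_path_measure)
  have "AE \<omega> in path_measure G (positional e) \<pi>2 v. False"
    using AE_visiting[OF stop s1 fair, of v] AE_path_start[of v G "positional e" \<pi>2]
      AE_path_step[of G "positional e" \<pi>2 v]
  proof eventually_elim
    case (elim \<omega>)
    have "\<omega> n \<in> C" for n
    proof (induction n)
      case 0
      then show ?case using elim(2) C(2) by simp
    next
      case (Suc n)
      have step: "\<omega> (Suc n) \<in> set_pmf (next_vertex G (positional e) \<pi>2 (map \<omega> [0..<Suc n]))"
        using elim(3) by blast
      show ?case
      proof (cases "\<omega> n \<in> V1 G")
        case True
        then show ?thesis using step e(2)[OF True Suc] by (simp add: next_vertex_def positional_def)
      next
        case False
        then show ?thesis
          using step set_pmf_next_vertex[OF G s1 s2, of "map \<omega> [0..<Suc n]"] stay2[OF Suc False] by auto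
      qed
    qed
    then show ?case using elim(1) C(1) by (auto simp: visiting_def)
  qed
  then show False by (simp add: AE_False)
qed

lemma expectation_pos:
  fixes e :: "'v \<Rightarrow> ennreal"
  assumes "u \<in> set_pmf p" "0 < e u"
  shows "0 < (\<integral>\<^sup>+x. e x \<partial>measure_pmf p)"
proof (rule ccontr)
  assume "\<not> ?thesis"
  then have "AE x in measure_pmf p. e x = 0" by (simp add: nn_integral_0_iff_AE)
  then show False using assms by (auto simp: AE_measure_pmf_iff)
qed

text \<open>Such an \<open>e\<close> vanishes off \<open>A\<close>, so adding a vertex with a small positive value keeps all inequalities; once
  \<open>A\<close> is everything, a large multiple of \<open>1 - e\<close> is a Lyapunov function.\<close>

definition progress ::
    "('v::finite, 'x) stochastic_game_scheme \<Rightarrow> 'v set \<Rightarrow> ('v \<Rightarrow> 'v) \<Rightarrow> ('v \<Rightarrow> ennreal) \<Rightarrow> bool" where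
  "progress G A d e \<longleftrightarrow> terminal G \<subseteq> A \<and> (\<forall>v\<in>V2 G. d v \<in> post G v) \<and>
     (\<forall>v. e v \<le> 1) \<and> (\<forall>v. 0 < e v \<longleftrightarrow> v \<in> A) \<and>
     (\<forall>v\<in>A - terminal G. \<forall>p\<in>moves G d v. e v < (\<integral>\<^sup>+u. e u \<partial>p))"

lemma progress_extend:
  assumes G: "stochastic_game G" and pr: "progress G A d e" and a: "a \<notin> A"
    and enter1: "a \<in> V1 G \<Longrightarrow> post G a \<subseteq> A"
    and enter2: "a \<notin> V1 G \<Longrightarrow> post G a \<inter> A \<noteq> {}"
  shows "\<exists>d e. progress G (insert a A) d e"
proof -
  have sub: "terminal G \<subseteq> A" and d: "\<And>v. v \<in> V2 G \<Longrightarrow> d v \<in> post G v"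
    and e: "\<And>v. e v \<le> 1" "\<And>v. 0 < e v \<longleftrightarrow> v \<in> A"
    and inc: "\<And>v p. v \<in> A \<Longrightarrow> v \<notin> terminal G \<Longrightarrow> p \<in> moves G d v \<Longrightarrow> e v < (\<integral>\<^sup>+u. e u \<partial>p)"
    using pr unfolding progress_def by blast+
  \<comment> \<open>\<open>u\<close> is constrained only when Player 2 owns \<open>a\<close>;
    elsewhere \<open>moves\<close> does not consult \<open>d\<close>.\<close>
  obtain u where u: "a \<in> V2 G \<Longrightarrow> u \<in> post G a \<inter> A"
    using enter2 G by (cases "a \<in> V2 G") (auto simp: stochastic_game_def)
  define d' where "d' = d(a := u)"
  have d': "d' v \<in> post G v" if "v \<in> V2 G" for v
    using d[OF that] u that by (cases "v = a") (simp_all add: d'_def)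
  have pos: "0 < (\<integral>\<^sup>+u. e u \<partial>p)" if p: "p \<in> moves G d' a" for p
  proof -
    have "\<exists>y\<in>set_pmf p. y \<in> A"
      using p u enter1 enter2 set_pmf_embed_delta[OF G, of a] probabilistic_vertex[OF G, of a]
      by (auto simp: moves_def d'_def split: if_split_asm)
    then show ?thesis using expectation_pos[of _ p e] e(2) by blast
  qed
  let ?E = "(\<lambda>p. \<integral>\<^sup>+u. e u \<partial>measure_pmf p) ` moves G d' a"
  have E: "finite ?E" "?E \<noteq> {}" using finite_moves moves_nonempty[OF G] by auto
  \<comment> \<open>The new value \<open>x\<close> at \<open>a\<close> lies strictly below the old
    expectation of \<open>e\<close> after every move from \<open>a\<close>. Since
    \<open>e a = 0\<close>, raising it to \<open>x\<close> can only increase the expectations at the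
    other vertices.\<close>
  have "0 < min 1 (Min ?E)" using E pos by simp
  then obtain x where x: "0 < x" "x < min 1 (Min ?E)" using dense by blast
  have xE: "x < (\<integral>\<^sup>+u. e u \<partial>p)" if "p \<in> moves G d' a" for p
    using x(2) E that by (meson Min_le image_eqI min_less_iff_conj order.strict_trans2)
  define e' where "e' = e(a := x)"
  have "e a = 0" using a e(2)[of a] by (simp add: zero_less_iff_neq_zero)
  then have "e v \<le> e' v" for v by (simp add: e'_def)
  then have mono: "(\<integral>\<^sup>+u. e u \<partial>p) \<le> (\<integral>\<^sup>+u. e' u \<partial>p)" for p :: "'a pmf"
    by (intro nn_integral_mono)
  have "e' v < (\<integral>\<^sup>+u. e' u \<partial>p)"
    if v: "v \<in> insert a A" "v \<notin> terminal G" "p \<in> moves G d' v" for v p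
  proof (cases "v = a")
    case True
    then show ?thesis using xE[of p] v mono[of p] by (simp add: e'_def less_le_trans)
  next
    case False
    then show ?thesis using inc[of v p] v mono[of p] moves_fun_upd[of v a G d u]
      by (simp add: e'_def d'_def less_le_trans)
  qed
  moreover have "e' v \<le> 1" "0 < e' v \<longleftrightarrow> v \<in> insert a A" for v
    using e x by (auto simp: e'_def less_imp_le)
  ultimately have "progress G (insert a A) d' e'"
    unfolding progress_def using sub d' by (intro conjI ballI allI) auto
  then show ?thesis by blast
qed

text \<open>Take a maximal set \<open>A\<close> carrying a progress function. If no outside vertex
  can be added, every outside Player 1 vertex has a successor outside \<open>A\<close> and all other
  outside vertices have only such successors. That is the situation excluded by
  \<open>no_trap\<close>, so \<open>A\<close> is everything.\<close>

lemma proper_exists: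
  fixes G :: "('v::finite, 'x) stochastic_game_scheme"
  assumes G: "stochastic_game G" and stop: "stopping_under_fairness G"
    and fair: "\<pi>2 \<in> fair_strategies2 G"
  obtains d where "proper G d"
proof -
  \<comment> \<open>Starting from the terminal set, there is no vertex at which an increase must be
    checked.\<close>
  have "progress G (terminal G) (\<lambda>v. SOME u. u \<in> post G v) (indicator (terminal G))"
    using G some_in_eq unfolding progress_def stochastic_game_def
    by (simp add: indicator_def some_in_eq)
  then have "{A. \<exists>d e. progress G A d e} \<noteq> {}" by blast
  from finite_has_maximal[OF finite this] obtain A where A: "A \<in> {A. \<exists>d e. progress G A d e}"
    and max: "\<forall>B\<in>{A. \<exists>d e. progress G A d e}. A \<subseteq> B \<longrightarrow> A = B" ..
  from A obtain d e where pr: "progress G A d e" by blast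
  have "A = UNIV"
  proof (rule ccontr)
    assume "A \<noteq> UNIV"
    then obtain b where b: "b \<in> - A" by auto
    have "- A \<inter> terminal G = {}" using pr unfolding progress_def by blast
    have "\<exists>a\<in>- A. (a \<in> V1 G \<longrightarrow> post G a \<subseteq> A) \<and> (a \<notin> V1 G \<longrightarrow> post G a \<inter> A \<noteq> {})"
    proof (rule ccontr)
      assume "\<not> ?thesis"
      then show False
        by (intro no_trap[OF G stop fair \<open>- A \<inter> terminal G = {}\<close> b]) blast+
    qed
    then obtain a where a: "a \<notin> A" "a \<in> V1 G \<Longrightarrow> post G a \<subseteq> A" "a \<notin> V1 G \<Longrightarrow> post G a \<inter> A \<noteq> {}"
      by blast
    have "insert a A \<in> {A. \<exists>d e. progress G A d e}"
      using progress_extend[OF G pr a] by simp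
    with max have "A \<subseteq> insert a A \<longrightarrow> A = insert a A" ..
    then show False using a(1) by blast
  qed
  then have d: "\<And>v. v \<in> V2 G \<Longrightarrow> d v \<in> post G v" and e: "\<And>v. e v \<le> 1"
    and inc: "\<And>v p. v \<notin> terminal G \<Longrightarrow> p \<in> moves G d v \<Longrightarrow> e v < (\<integral>\<^sup>+u. e u \<partial>p)"
    using pr unfolding progress_def by blast+
  \<comment> \<open>\<open>gap\<close> is the expected gain of \<open>e\<close> under a move from a
    nonterminal vertex. There are finitely many such pairs, so the sum \<open>K\<close> of the
    inverse gaps is finite and scales every gain to at least 1.\<close>
  define S where "S = (SIGMA v:- terminal G. moves G d v)"
  define gap where "gap = (\<lambda>(v, p). (\<integral>\<^sup>+u. e u \<partial>measure_pmf p) - e v)"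
  define K where "K = (\<Sum>s\<in>S. inverse (gap s))"
  have "finite S" unfolding S_def using finite_moves by (intro finite_SigmaI) auto
  have exp1: "(\<integral>\<^sup>+u. e u \<partial>p) \<le> 1" for p :: "'v pmf"
    using nn_integral_mono[of "measure_pmf p" e "\<lambda>_. 1"] e by simp
  have gap: "0 < gap s" "gap s \<le> 1" if "s \<in> S" for s
    using that inc exp1 unfolding S_def gap_def
    by (auto simp: diff_gr0_ennreal less_imp_le intro: order_trans[OF diff_le_self_ennreal])
  have "K < \<top>" unfolding K_def using gap(1) \<open>finite S\<close> by (auto simp: less_top[symmetric] zero_less_iff_neq_zero)
  have K: "1 \<le> K * gap s" if s: "s \<in> S" for s
  proof -
    have "inverse (gap s) \<le> K" unfolding K_def using \<open>finite S\<close> s by (intro member_le_sum) auto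
    then have "inverse (gap s) * gap s \<le> K * gap s" by (rule mult_right_mono) simp
    moreover have "inverse (gap s) * gap s = 1"
      using gap[OF s] by (metis ennreal_divide_self divide_ennreal_def ennreal_one_less_top mult.commute
          not_gr_zero order.strict_trans1)
    ultimately show ?thesis by simp
  qed
  define w where "w v = K * (1 - e v)" for v
  have "indicator (- terminal G) v + (\<integral>\<^sup>+u. w u \<partial>p) \<le> w v" if p: "p \<in> moves G d v" for v p
  proof (cases "v \<in> terminal G")
    case True
    have "set_pmf p \<subseteq> {v}" using set_pmf_moves[OF G d p] post_terminal[OF True] by simp
    then show ?thesis using True by (simp add: nn_integral_pmf_const_support)
  next
    case False
    let ?I = "\<integral>\<^sup>+u. e u \<partial>p"
    have "(\<integral>\<^sup>+u. 1 - e u \<partial>p) = 1 - ?I"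
      using exp1[of p] e by (subst nn_integral_diff) (auto simp: top_unique)
    then have "(\<integral>\<^sup>+u. w u \<partial>p) = K * (1 - ?I)" unfolding w_def by (simp add: nn_integral_cmult)
    moreover have "1 \<le> K * (?I - e v)" using K[of "(v, p)"] p False by (simp add: S_def gap_def)
    ultimately have "indicator (- terminal G) v + (\<integral>\<^sup>+u. w u \<partial>p) \<le> K * (?I - e v) + K * (1 - ?I)"
      using False by (simp add: add_right_mono)
    also have "\<dots> = K * ((1 - ?I) + (?I - e v))" by (simp add: distrib_left add.commute)
    also have "(1 - ?I) + (?I - e v) = 1 - e v"
      using inc[OF False p] exp1[of p] by (simp add: add_diff_eq_ennreal diff_add_cancel_ennreal less_imp_le)
    finally show ?thesis by (simp add: w_def)
  qed
  moreover have "w v < \<top>" for v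
  proof -
    have "1 - e v < \<top>" by (simp add: less_top[symmetric])
    then show ?thesis using \<open>K < \<top>\<close> by (simp add: w_def ennreal_mult_less_top)
  qed
  ultimately have "proper G d" using d by (auto simp: proper_def lyapunov_def)
  then show ?thesis by (rule that)
qed

section \<open>The lower bound and the minimax equality\<close>

text \<open>Almost every play is eventually constant at a vertex where \<open>h\<close> is 0, and
  \<open>h\<close> is bounded by the sum of its values. Dominated convergence thus works from almost
  sure termination, without any bound on the expected time.\<close>

lemma expectation_vanishes:
  fixes h :: "'v::finite \<Rightarrow> ennreal"
  assumes "stopping_under_fairness G" "\<pi>1 \<in> strategies1 G" "\<pi>2 \<in> fair_strategies2 G"
    and "\<And>v. h v < \<top>" "\<And>v. v \<in> terminal G \<Longrightarrow> h v = 0"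
  shows "(\<lambda>n. \<integral>\<^sup>+\<omega>. h (\<omega> n) \<partial>path_measure G \<pi>1 \<pi>2 v) \<longlonglongrightarrow> 0"
proof -
  let ?P = "path_measure G \<pi>1 \<pi>2 v"
  interpret prob_space ?P by (rule prob_space_path_measure)
  define b where "b = (\<Sum>v\<in>UNIV. h v)"
  have hb: "h v \<le> b" for v unfolding b_def by (rule member_le_sum) auto
  have "b < \<top>" using assms(4) by (simp add: b_def)
  have lim: "AE \<omega> in ?P. (\<lambda>n. h (\<omega> n)) \<longlonglongrightarrow> 0"
    using AE_visiting[OF assms(1-3), of v]
  proof eventually_elim
    case (elim \<omega>)
    then obtain k where k: "\<omega> \<in> paths G" "\<omega> k \<in> terminal G" by (auto simp: visiting_def)
    have "h (\<omega> n) = 0" if "n \<ge> k" for n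
      using paths_terminal_absorbing[OF k that] assms(5)[OF k(2)] by simp
    then show ?case by (intro tendsto_eventually eventually_sequentiallyI)
  qed
  have "(\<lambda>n. \<integral>\<^sup>+\<omega>. h (\<omega> n) \<partial>?P) \<longlonglongrightarrow> (\<integral>\<^sup>+\<omega>. 0 \<partial>?P)"
    using hb lim \<open>b < \<top>\<close>
    by (intro nn_integral_dominated_convergence[where w = "\<lambda>_. b"])
       (auto simp: emeasure_space_1[unfolded space_path_measure])
  then show ?thesis by simp
qed

text \<open>Player 1 plays a maximising successor. One step then preserves
  \<open>response_value\<close> at Player 1 and probabilistic vertices, and \<open>opt\<close>,
  averaged over a possibly randomised choice, gives the inequality at Player 2 vertices. This is the
  submartingale condition for every history.\<close>

lemma optimal_response_lower_bound:
  fixes G :: "('v::finite, 'x) reward_game_scheme"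
  assumes G: "reward_game G" and stop: "stopping_under_fairness G" and d: "proper G d"
    and opt: "\<And>v u. v \<in> V2 G \<Longrightarrow> u \<in> post G v \<Longrightarrow>
      response_value G d v \<le> ennreal (reward G v) + response_value G d u"
  obtains \<pi>1 where "\<pi>1 \<in> memoryless_strategies1 G"
    "\<And>\<pi>2 v. \<pi>2 \<in> fair_strategies2 G \<Longrightarrow> response_value G d v \<le> expected_reward G \<pi>1 \<pi>2 v"
proof -
  let ?h = "response_value G d"
  have sg: "stochastic_game G" using G by (simp add: reward_game_def)
  \<comment> \<open>At a Player 1 vertex all moves are point masses, so a maximal move names a
    successor.\<close>
  have "\<exists>u. v \<in> V1 G \<longrightarrow> u \<in> post G v \<and> ?h v = ennreal (reward G v) + ?h u" for v
    by (rule response_value_attained[OF sg, of d v]) (auto simp: moves_def split: if_split_asm)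
  then obtain c where c: "\<And>v. v \<in> V1 G \<Longrightarrow> c v \<in> post G v \<and> ?h v = ennreal (reward G v) + ?h (c v)"
    by metis
  have s1: "positional c \<in> strategies1 G"
    unfolding strategies1_def using c by (intro positional_strategies) blast
  have step: "?h (last xs) \<le> ennreal (reward G (last xs)) +
      (\<integral>\<^sup>+u. ?h u \<partial>next_vertex G (positional c) \<pi>2 xs)"
    if s2: "\<pi>2 \<in> strategies2 G" and xs: "xs \<noteq> []" for \<pi>2 xs
  proof -
    consider "last xs \<in> V1 G" | "last xs \<notin> V1 G" "last xs \<in> V2 G" | "last xs \<notin> V1 G" "last xs \<notin> V2 G"
      by blast
    then show ?thesis
    proof cases
      case 1
      then show ?thesis using c[OF 1] by (simp add: next_vertex_def positional_def)
    next
      case 2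
      have sub: "set_pmf (\<pi>2 xs) \<subseteq> post G (last xs)"
        using strategy_support[OF _ xs 2(2)] s2 by (simp add: strategies2_def)
      have "?h (last xs) = (\<integral>\<^sup>+u. ?h (last xs) \<partial>\<pi>2 xs)" by simp
      also have "\<dots> \<le> (\<integral>\<^sup>+u. ennreal (reward G (last xs)) + ?h u \<partial>\<pi>2 xs)"
        using sub opt[OF 2(2)] by (intro nn_integral_mono_AE) (auto simp: AE_measure_pmf_iff)
      also have "\<dots> = ennreal (reward G (last xs)) + (\<integral>\<^sup>+u. ?h u \<partial>\<pi>2 xs)"
        by (simp add: nn_integral_add)
      finally show ?thesis using 2 by (simp add: next_vertex_def)
    next
      case 3
      then have "moves G d (last xs) = {embed_pmf (delta G (last xs))}" by (simp add: moves_def)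
      then have "?h (last xs) = ennreal (reward G (last xs)) +
          (\<integral>\<^sup>+u. ?h u \<partial>measure_pmf (embed_pmf (delta G (last xs))))"
        by (subst response_value_unfold) (simp add: bellman_def)
      then show ?thesis using 3 by (simp add: next_vertex_def)
    qed
  qed
  have "?h v \<le> expected_reward G (positional c) \<pi>2 v" if fair: "\<pi>2 \<in> fair_strategies2 G" for \<pi>2 v
  proof (rule LIMSEQ_le_const)
    let ?E = "expected_reward G (positional c) \<pi>2 v"
    have "(\<lambda>n. \<integral>\<^sup>+\<omega>. ?h (\<omega> n) \<partial>path_measure G (positional c) \<pi>2 v) \<longlonglongrightarrow> 0"
      using response_value_finite[OF G d] response_value_terminal[OF G d]
      by (intro expectation_vanishes[OF stop s1 fair])
    then have "(\<lambda>n. ?E + (\<integral>\<^sup>+\<omega>. ?h (\<omega> n) \<partial>path_measure G (positional c) \<pi>2 v)) \<longlonglongrightarrow> ?E + 0"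
      by (intro tendsto_add tendsto_const)
    then show "(\<lambda>n. ?E + (\<integral>\<^sup>+\<omega>. ?h (\<omega> n) \<partial>path_measure G (positional c) \<pi>2 v)) \<longlonglongrightarrow> ?E"
      by simp
    have s2: "\<pi>2 \<in> strategies2 G" using fair by (simp add: fair_strategies2_def)
    have "?h v \<le> ?E + (\<integral>\<^sup>+\<omega>. ?h (\<omega> n) \<partial>path_measure G (positional c) \<pi>2 v)" for n
      unfolding expected_reward_def total_reward_def
      by (rule submartingale_bound[where c = "\<lambda>v. ennreal (reward G v)"]) (rule step[OF s2])
    then show "\<exists>N. \<forall>n\<ge>N. ?h v \<le> ?E + (\<integral>\<^sup>+\<omega>. ?h (\<omega> n) \<partial>path_measure G (positional c) \<pi>2 v)"
      by blast
  qed
  moreover have "positional c \<in> memoryless_strategies1 G"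
    using s1 by (simp add: memoryless_strategies1_def memoryless_on_positional)
  ultimately show ?thesis using that by blast
qed

theorem theorem9:
  fixes G :: "'v::finite reward_game"
  assumes "reward_game G"
    and "stopping_under_fairness G"
  shows "\<forall>v. (SUP \<pi>1\<in>strategies1 G. INF \<pi>2\<in>fair_strategies2 G. expected_reward G \<pi>1 \<pi>2 v) =
             (SUP \<pi>1\<in>memoryless_strategies1 G. INF \<pi>2\<in>memoryless_fair_strategies2 G.
                expected_reward G \<pi>1 \<pi>2 v)"
proof (cases "fair_strategies2 G = {}")
  case True
  have sg: "stochastic_game G" using assms(1) by (simp add: reward_game_def)
  \<comment> \<open>The infimum over no fair strategies is \<top>, but the outer supremum is \<top>
    only over a nonempty set, so some Player 1 strategy must be exhibited.\<close>
  have "positional (\<lambda>v. SOME u. u \<in> post G v) \<in> memoryless_strategies1 G"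
    unfolding memoryless_strategies1_def strategies1_def
    using sg by (auto simp: memoryless_on_positional stochastic_game_def some_in_eq
        intro!: positional_strategies)
  then have "memoryless_strategies1 G \<noteq> {}" "strategies1 G \<noteq> {}"
    by (auto simp: memoryless_strategies1_def)
  moreover have "memoryless_fair_strategies2 G = {}"
    using True by (simp add: memoryless_fair_strategies2_def)
  ultimately show ?thesis using True by simp
next
  case False
  have sg: "stochastic_game G" using assms(1) by (simp add: reward_game_def)
  obtain d0 where "proper G d0" using False proper_exists[OF sg assms(2)] by blast
  then obtain d where d: "proper G d"
    and opt: "\<And>v u. v \<in> V2 G \<Longrightarrow> u \<in> post G v \<Longrightarrow>
      response_value G d v \<le> ennreal (reward G v) + response_value G d u"
    using optimal_proper_exists[OF assms(1)] by blast
  obtain \<sigma> where \<sigma>: "\<sigma> \<in> memoryless_strategies1 G"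
    "\<And>\<pi>2 v. \<pi>2 \<in> fair_strategies2 G \<Longrightarrow> response_value G d v \<le> expected_reward G \<sigma> \<pi>2 v"
    using optimal_response_lower_bound[OF assms d opt] by blast
  have fair: "positional d \<in> memoryless_fair_strategies2 G"
    by (rule proper_memoryless_fair[OF sg d])
  \<comment> \<open>Stated for arbitrary strategy classes containing the two optimal strategies, so
    that both sides of the claim are instances.\<close>
  have minimax: "(SUP \<pi>1\<in>S1. INF \<pi>2\<in>S2. expected_reward G \<pi>1 \<pi>2 v) = response_value G d v"
    if "S1 \<subseteq> strategies1 G" "\<sigma> \<in> S1" "S2 \<subseteq> fair_strategies2 G" "positional d \<in> S2" for S1 S2 v
  proof (rule antisym)
    show "(SUP \<pi>1\<in>S1. INF \<pi>2\<in>S2. expected_reward G \<pi>1 \<pi>2 v) \<le> response_value G d v"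
      using that(1,4) by (intro SUP_least INF_lower2[OF that(4)] expected_reward_positional_le) blast
    show "response_value G d v \<le> (SUP \<pi>1\<in>S1. INF \<pi>2\<in>S2. expected_reward G \<pi>1 \<pi>2 v)"
      using that(3) by (intro SUP_upper2[OF that(2)] INF_greatest \<sigma>(2)) blast
  qed
  have "\<sigma> \<in> strategies1 G" "positional d \<in> fair_strategies2 G"
    "memoryless_strategies1 G \<subseteq> strategies1 G" "memoryless_fair_strategies2 G \<subseteq> fair_strategies2 G"
    using \<sigma>(1) fair by (auto simp: memoryless_strategies1_def memoryless_fair_strategies2_def)
  then show ?thesis using \<sigma>(1) fair by (simp add: minimax)
qed

end
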